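(* Let $(\delta^1,\dots,\delta^N)\in\mathbb{R}^N_+$ be a given cost profile and let $F^\circ=(F^{1\,\circ},\dots,F^{N\,\circ})$, with $F^{i\,\circ}\in\mathbb{R}^{m_i\times s_i}$, be a given strategy profile. Define $A_{\mathrm{cl}}(F^\circ):=A+\sum_{j\in\mathsf N}B^jF^{j\,\circ}C^j$. Then, for each player $i\in\mathsf N$, the following statements are equivalent: (1) $J^i(F^{i\,\circ},F^{-i\,\circ})<\delta^i$ and $\sigma(A_{\mathrm{cl}}(F^\circ))\subset\mathbb{D}$. (2) There exists a matrix $P^i\succ 0$ such that $$A_{\mathrm{cl}}(F^\circ)^\top P^iA_{\mathrm{cl}}(F^\circ)-P^i+{C^i}^\top Q^iC^i+{C^i}^\top{F^{i\,\circ}}^\top R^iF^{i\,\circ}C^i\prec 0,\qquad x_0^\top P^ix_0<\delta^i.$$ Thus $F^\circ$ is a stabilizing output feedback guaranteed cost equilibrium (OF-GCE) for the cost profile $(\delta^1,\dots,\delta^N)$ if and only if (2) holds for every $i\in\mathsf N$.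
   Context: Players: $\mathsf N=\{1,\dots,N\}$. Discrete-time game: $x_{k+1}=Ax_k+\sum_{i\in\mathsf N}B^iu^i_k$, $k\in\{0,1,2,\dots\}$, with given initial condition $x_0\in\mathbb{R}^n$, $A\in\mathbb{R}^{n\times n}$, $B^i\in\mathbb{R}^{n\times m_i}$. Player $i$ observes $y^i_k=C^ix_k$, where $C^i\in\mathbb{R}^{s_i\times n}$ has rank $s_i\le n$, and uses static output feedback $u^i_k=F^iy^i_k$, $F^i\in\mathbb{R}^{m_i\times s_i}$. Weights: $Q^i\in\mathbb{R}^{s_i\times s_i}$ symmetric, $Q^i\succeq0$; $R^i\in\mathbb{R}^{m_i\times m_i}$ symmetric, $R^i\succ0$. The cost of player $i$ is $$J^i(F^i,F^{-i})=\sum_{k=0}^\infty x_k^\top\big({C^i}^\top Q^iC^i+{C^i}^\top{F^i}^\top R^iF^iC^i\big)x_k,$$ where $x_{k+1}=(A+\sum_{j\in\mathsf N}B^jF^jC^j)x_k$ with initial condition $x_0$. $F^{-i}$ denotes the strategies of all players other than $i$. $\mathbb{D}=\{\lambda\in\mathbb{C}:|\lambda|<1\}$ and $\sigma(\cdot)$ is the spectrum. $M\succ0$ ($\prec0$) means symmetric positive (negative) definite. $\mathbb{R}^N_+$ is the set of vectors with positive entries. The set of stabilizing profiles $\mathscr F=\{(F^1,\dots,F^N):\sigma(A+\sum_{i\in\mathsf N}B^iF^iC^i)\subset\mathbb{D}\}$ is assumed non-empty. Guaranteed cost response: $\mathfrak g^i(\delta^i,F^{-i})=\{F^i\in\mathbb{R}^{m_i\times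 s_i}: J^i(F^i,F^{-i})<\delta^i,\ (F^i,F^{-i})\in\mathscr F\}$. A profile $F^\circ\in\mathscr F$ is an OF-GCE for the cost profile if $F^{i\,\circ}\in\mathfrak g^i(\delta^i,F^{-i\,\circ})$ for every $i\in\mathsf N$. *)

theory Defs
  imports "Jordan_Normal_Form.Spectral_Radius" "Jordan_Normal_Form.DL_Rank"
    "HOL-Library.Extended_Real"
begin

definition pos_semidef :: "nat \<Rightarrow> real mat \<Rightarrow> bool" where
  "pos_semidef d M \<longleftrightarrow> M \<in> carrier_mat d d \<and> transpose_mat M = M
     \<and> (\<forall>x\<in>carrier_vec d. 0 \<le> x \<bullet> (M *\<^sub>v x))"

definition pos_def :: "nat \<Rightarrow> real mat \<Rightarrow> bool" where
  "pos_def d M \<longleftrightarrow> M \<in> carrier_mat d d \<and> transpose_mat M = M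
     \<and> (\<forall>x\<in>carrier_vec d. x \<noteq> 0\<^sub>v d \<longrightarrow> 0 < x \<bullet> (M *\<^sub>v x))"

definition neg_def :: "nat \<Rightarrow> real mat \<Rightarrow> bool" where
  "neg_def d M \<longleftrightarrow> M \<in> carrier_mat d d \<and> transpose_mat M = M
     \<and> (\<forall>x\<in>carrier_vec d. x \<noteq> 0\<^sub>v d \<longrightarrow> x \<bullet> (M *\<^sub>v x) < 0)"

definition unit_disc :: "complex set" where
  "unit_disc = {z. cmod z < 1}"

(* The dimensions m_i, s_i depend on the player, so matrices are taken from
   carrier_mat rather than from types indexed by their dimension. *)
record of_game =
  num_players :: nat
  state_dim :: nat
  input_dim :: "nat \<Rightarrow> nat"
  output_dim :: "nat \<Rightarrow> nat"
  Amat :: "real mat"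
  Bmat :: "nat \<Rightarrow> real mat"
  Cmat :: "nat \<Rightarrow> real mat"
  Qmat :: "nat \<Rightarrow> real mat"
  Rmat :: "nat \<Rightarrow> real mat"
  init_state :: "real vec"

definition players :: "of_game \<Rightarrow> nat set" where
  "players G = {1..num_players G}"

definition wf_game :: "of_game \<Rightarrow> bool" where
  "wf_game G \<longleftrightarrow> 1 \<le> num_players G
     \<and> Amat G \<in> carrier_mat (state_dim G) (state_dim G)
     \<and> init_state G \<in> carrier_vec (state_dim G)
     \<and> (\<forall>i\<in>players G.
          Bmat G i \<in> carrier_mat (state_dim G) (input_dim G i)
        \<and> Cmat G i \<in> carrier_mat (output_dim G i) (state_dim G)
        \<and> output_dim G i \<le> state_dim G
        \<and> vec_space.rank (output_dim G i) (Cmat G i) = output_dim G i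
        \<and> pos_semidef (output_dim G i) (Qmat G i)
        \<and> pos_def (input_dim G i) (Rmat G i))"

(* Profiles are functions on nat; only their values on the players are ever used. *)
definition profiles :: "of_game \<Rightarrow> (nat \<Rightarrow> real mat) set" where
  "profiles G = {F. \<forall>i\<in>players G. F i \<in> carrier_mat (input_dim G i) (output_dim G i)}"

definition closed_loop :: "of_game \<Rightarrow> (nat \<Rightarrow> real mat) \<Rightarrow> real mat" where
  "closed_loop G F = Amat G +
     finsum (module_mat TYPE(real) (state_dim G) (state_dim G))
       (\<lambda>j. Bmat G j * F j * Cmat G j) (players G)"

primrec trajectory :: "of_game \<Rightarrow> (nat \<Rightarrow> real mat) \<Rightarrow> nat \<Rightarrow> real vec" where
  "trajectory G F 0 = init_state G"
| "trajectory G F (Suc k) = closed_loop G F *\<^sub>v trajectory G F k"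

(* The stage costs are nonnegative; summing them in ereal makes the cost of a
   divergent closed loop infinity instead of an unspecified real. *)
definition cost :: "of_game \<Rightarrow> nat \<Rightarrow> (nat \<Rightarrow> real mat) \<Rightarrow> ereal" where
  "cost G i F = (\<Sum>k. ereal (trajectory G F k \<bullet>
     ((transpose_mat (Cmat G i) * Qmat G i * Cmat G i
       + transpose_mat (Cmat G i) * transpose_mat (F i) * Rmat G i * F i * Cmat G i)
      *\<^sub>v trajectory G F k)))"

(* The spectrum is the complex one, hence the embedding of the real matrix. *)
definition closed_loop_spectrum :: "of_game \<Rightarrow> (nat \<Rightarrow> real mat) \<Rightarrow> complex set" where
  "closed_loop_spectrum G F = spectrum (map_mat complex_of_real (closed_loop G F))"

definition stabilizing :: "of_game \<Rightarrow> (nat \<Rightarrow> real mat) set" where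
  "stabilizing G = {F \<in> profiles G. closed_loop_spectrum G F \<subseteq> unit_disc}"

(* F stands for the strategies of the other players: its i-th entry is overwritten. *)
definition guaranteed_cost_response ::
    "of_game \<Rightarrow> nat \<Rightarrow> real \<Rightarrow> (nat \<Rightarrow> real mat) \<Rightarrow> real mat set" where
  "guaranteed_cost_response G i d F =
     {Fi \<in> carrier_mat (input_dim G i) (output_dim G i).
        cost G i (F(i := Fi)) < ereal d \<and> F(i := Fi) \<in> stabilizing G}"

definition of_gce :: "of_game \<Rightarrow> (nat \<Rightarrow> real) \<Rightarrow> (nat \<Rightarrow> real mat) \<Rightarrow> bool" where
  "of_gce G \<delta> F \<longleftrightarrow> F \<in> stabilizing G
     \<and> (\<forall>i\<in>players G. F i \<in> guaranteed_cost_response G i (\<delta> i) F)"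

definition cost_certificate ::
    "of_game \<Rightarrow> nat \<Rightarrow> real \<Rightarrow> (nat \<Rightarrow> real mat) \<Rightarrow> real mat \<Rightarrow> bool" where
  "cost_certificate G i d F P \<longleftrightarrow> pos_def (state_dim G) P
     \<and> neg_def (state_dim G)
         (transpose_mat (closed_loop G F) * P * closed_loop G F - P
          + transpose_mat (Cmat G i) * Qmat G i * Cmat G i
          + transpose_mat (Cmat G i) * transpose_mat (F i) * Rmat G i * F i * Cmat G i)
     \<and> init_state G \<bullet> (P *\<^sub>v init_state G) < d"

end

theory Submission
  imports Defs
begin

text \<open>For a stable \<open>A\<close> the cost with stage weight \<open>W\<close> is the quadratic form at \<open>x\<^sub>0\<close> of
  \<open>P = (\<Sum>k. (A\<^sup>T)\<^sup>k W A\<^sup>k)\<close>, which solves the Lyapunov equation \<open>A\<^sup>T P A - P + W = 0\<close>. Adding a small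
  multiple of the solution \<open>H\<close> for \<open>W = 1\<close> makes the equation a strict inequality and \<open>P\<close> definite,
  at an arbitrarily small increase of the value at \<open>x\<^sub>0\<close>. Conversely, a certificate \<open>P\<close> is a
  quadratic Lyapunov function whose decrease along trajectories dominates the stage cost.\<close>

section \<open>Matrix powers, quadratic forms and definiteness\<close>

lemma smult_pow_mat:
  fixes A :: "'a :: comm_semiring_1 mat"
  assumes A: "A \<in> carrier_mat n n"
  shows "(c \<cdot>\<^sub>m A) ^\<^sub>m k = c ^ k \<cdot>\<^sub>m A ^\<^sub>m k"
proof (induction k)
  case 0
  show ?case using A by (intro eq_matI) auto
next
  case (Suc k)
  have "(c \<cdot>\<^sub>m A) ^\<^sub>m Suc k = (c ^ k \<cdot>\<^sub>m A ^\<^sub>m k) * (c \<cdot>\<^sub>m A)"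
    using Suc by simp
  also have "\<dots> = c ^ k \<cdot>\<^sub>m (A ^\<^sub>m k * (c \<cdot>\<^sub>m A))"
    using A by (intro mult_smult_assoc_mat[of _ n n]) auto
  also have "A ^\<^sub>m k * (c \<cdot>\<^sub>m A) = c \<cdot>\<^sub>m (A ^\<^sub>m k * A)"
    using A by (intro mult_smult_distrib[of _ n n]) auto
  finally show ?case using A by (intro eq_matI) (auto simp: ac_simps)
qed

text \<open>\<open>^\<^sub>m\<close> adds its new factor on the right, whereas a trajectory applies
  it on the left. The induction generalises over \<open>x\<close> so that its hypothesis can be used
  at \<open>A *\<^sub>v x\<close>.\<close>

lemma pow_mat_Suc_mult_vec:
  fixes A :: "'a :: comm_semiring_1 mat"
  assumes A: "A \<in> carrier_mat n n" and x: "x \<in> carrier_vec n"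
  shows "A ^\<^sub>m Suc k *\<^sub>v x = A *\<^sub>v (A ^\<^sub>m k *\<^sub>v x)"
  using x
proof (induction k arbitrary: x)
  case 0
  then show ?case using A by simp
next
  case (Suc k)
  have Ax: "A *\<^sub>v x \<in> carrier_vec n"
    using A Suc.prems by simp
  have "A ^\<^sub>m Suc (Suc k) *\<^sub>v x = A ^\<^sub>m Suc k *\<^sub>v (A *\<^sub>v x)"
    using assoc_mult_mat_vec[OF pow_carrier_mat[OF A, of "Suc k"] A Suc.prems] by simp
  also have "\<dots> = A *\<^sub>v (A ^\<^sub>m k *\<^sub>v (A *\<^sub>v x))"
    by (rule Suc.IH[OF Ax])
  also have "A ^\<^sub>m k *\<^sub>v (A *\<^sub>v x) = A ^\<^sub>m Suc k *\<^sub>v x"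
    using assoc_mult_mat_vec[of "A ^\<^sub>m k" n n A n x] A Suc.prems by simp
  finally show ?case .
qed

text \<open>Reduces convergence of a series of quadratic forms to convergence of the matrix
  entries.\<close>

lemma scalar_prod_mult_mat_vec_sum:
  assumes "M \<in> carrier_mat n m" "x \<in> carrier_vec n" "y \<in> carrier_vec m"
  shows "x \<bullet> (M *\<^sub>v y) = (\<Sum>i<n. \<Sum>j<m. x $ i * (M $$ (i,j) * y $ j))"
proof -
  have "x \<bullet> (M *\<^sub>v y) = (\<Sum>i<n. x $ i * (\<Sum>j<m. M $$ (i,j) * y $ j))"
    using assms by (auto simp: scalar_prod_def atLeast0LessThan intro!: sum.cong)
  then show ?thesis
    by (simp add: sum_distrib_left)
qed

lemma scalar_prod_transpose_mult_mat_vec: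
  fixes A :: "'a :: comm_semiring_0 mat"
  assumes "A \<in> carrier_mat m n" "x \<in> carrier_vec n" "y \<in> carrier_vec m"
  shows "x \<bullet> (transpose_mat A *\<^sub>v y) = (A *\<^sub>v x) \<bullet> y"
  using transpose_vec_mult_scalar[OF assms] assms
    comm_scalar_prod[of x n "transpose_mat A *\<^sub>v y"] comm_scalar_prod[of y m "A *\<^sub>v x"]
  by simp

text \<open>Used with one step of the dynamics for the Lyapunov difference, and with
  \<open>A ^\<^sub>m k\<close> to pull the stage cost at time \<open>k\<close> back to the initial
  state.\<close>

lemma congruence_scalar_prod:
  fixes A :: "'a :: comm_semiring_0 mat"
  assumes A: "A \<in> carrier_mat m n" and W: "W \<in> carrier_mat m m"
    and x: "x \<in> carrier_vec n" and y: "y \<in> carrier_vec n"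
  shows "x \<bullet> ((transpose_mat A * W * A) *\<^sub>v y) = (A *\<^sub>v x) \<bullet> (W *\<^sub>v (A *\<^sub>v y))"
proof -
  have "(transpose_mat A * W * A) *\<^sub>v y = transpose_mat A *\<^sub>v (W *\<^sub>v (A *\<^sub>v y))"
    using assms assoc_mult_mat_vec[of "transpose_mat A * W" n m A n y]
      assoc_mult_mat_vec[of "transpose_mat A" n m W m "A *\<^sub>v y"] by simp
  then show ?thesis
    using assms by (simp add: scalar_prod_transpose_mult_mat_vec)
qed

lemma congruence_symmetric:
  fixes A :: "'a :: comm_semiring_0 mat"
  assumes A: "A \<in> carrier_mat m n" and W: "W \<in> carrier_mat m m" and "transpose_mat W = W"
  shows "transpose_mat (transpose_mat A * W * A) = transpose_mat A * W * A"
proof -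
  have "transpose_mat (transpose_mat A * W * A) = transpose_mat A * transpose_mat (transpose_mat A * W)"
    using A W by (intro transpose_mult[of _ n m]) auto
  also have "transpose_mat (transpose_mat A * W) = W * A"
    using A W assms(3) by (subst transpose_mult[of _ n m]) auto
  finally show ?thesis
    using A W by (simp add: assoc_mult_mat[of _ n m _ m _ n])
qed

lemma pos_semidef_congruence:
  assumes "pos_semidef m W" "A \<in> carrier_mat m n"
  shows "pos_semidef n (transpose_mat A * W * A)"
  using assms by (auto simp: pos_semidef_def congruence_scalar_prod congruence_symmetric)

lemma pos_def_imp_pos_semidef: "pos_def d M \<Longrightarrow> pos_semidef d M"
  unfolding pos_def_def pos_semidef_def
  by (metis less_eq_real_def mult_mat_vec_carrier scalar_prod_left_zero)

lemma transpose_add_mat: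
  assumes "A \<in> carrier_mat n m" "B \<in> carrier_mat n m"
  shows "transpose_mat (A + B) = transpose_mat A + transpose_mat B"
  using assms by (intro eq_matI) auto

lemma add_mat_quadratic:
  fixes A :: "'a :: comm_semiring_0 mat"
  assumes "A \<in> carrier_mat n n" "B \<in> carrier_mat n n" "x \<in> carrier_vec n"
  shows "x \<bullet> ((A + B) *\<^sub>v x) = x \<bullet> (A *\<^sub>v x) + x \<bullet> (B *\<^sub>v x)"
  using assms by (simp add: add_mult_distrib_mat_vec[of _ n n] scalar_prod_add_distrib[of _ n])

lemma minus_mat_quadratic:
  fixes A :: "'a :: ring mat"
  assumes "A \<in> carrier_mat n n" "B \<in> carrier_mat n n" "x \<in> carrier_vec n"
  shows "x \<bullet> ((A - B) *\<^sub>v x) = x \<bullet> (A *\<^sub>v x) - x \<bullet> (B *\<^sub>v x)"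
  using assms by (simp add: minus_mult_distrib_mat_vec[of _ n n] scalar_prod_minus_distrib[of _ n])

lemma pos_semidef_add:
  assumes "pos_semidef n A" "pos_semidef n B"
  shows "pos_semidef n (A + B)"
  using assms by (auto simp: pos_semidef_def add_mat_quadratic transpose_add_mat[of _ n n])

section \<open>Geometric decay of the powers of a stable matrix\<close>

text \<open>Scaling keeps the eigenvectors; this carries the spectrum of a rescaled matrix back to
  the original one.\<close>

lemma eigenvalue_smult:
  fixes A :: "'a :: field mat"
  assumes A: "A \<in> carrier_mat n n" and c: "c \<noteq> 0" and ev: "eigenvalue (c \<cdot>\<^sub>m A) \<mu>"
  shows "eigenvalue A (\<mu> / c)"
proof -
  obtain v where v: "v \<in> carrier_vec n" "v \<noteq> 0\<^sub>v n" "(c \<cdot>\<^sub>m A) *\<^sub>v v = \<mu> \<cdot>\<^sub>v v"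
    using ev A unfolding eigenvalue_def eigenvector_def by auto
  have "A *\<^sub>v v = (1 / c) \<cdot>\<^sub>v ((c \<cdot>\<^sub>m A) *\<^sub>v v)"
    using A v(1) c by (intro eq_vecI) auto
  also have "\<dots> = (\<mu> / c) \<cdot>\<^sub>v v"
    unfolding v(3) by (simp add: smult_smult_assoc)
  finally show ?thesis
    using A v unfolding eigenvalue_def eigenvector_def by auto
qed

text \<open>Rescaling \<open>A\<close> by a number slightly above its spectral radius turns the uniform bound on the
  powers of a matrix with spectral radius below one into geometric decay.\<close>

lemma spectrum_unit_disc_imp_geometric_decay:
  fixes A :: "complex mat"
  assumes A: "A \<in> carrier_mat n n" and sp: "spectrum A \<subseteq> unit_disc"
  obtains r c where "0 < r" "r < 1"
    "\<forall>k. \<forall>i<n. \<forall>j<n. norm ((A ^\<^sub>m k) $$ (i,j)) \<le> c * r ^ k"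
proof (cases "n = 0")
  \<comment> \<open>A largest eigenvalue modulus exists only in positive dimension; in dimension 0
    the entry bound is vacuous.\<close>
  case True
  then show ?thesis using that[of "1/2" 0] by simp
next
  case False
  then have n: "n > 0" by simp
  \<comment> \<open>\<open>r\<close> lies strictly between the largest modulus and 1. Inserting 0
    makes the maximum that of a nonempty set and forces \<open>r\<close> to be positive.\<close>
  obtain r where r: "0 < r" "r < 1" "\<And>z. z \<in> spectrum A \<Longrightarrow> norm z < r"
  proof -
    have fin: "finite (insert 0 (norm ` spectrum A))"
      using card_finite_spectrum(1)[OF A] by simp
    have "Max (insert 0 (norm ` spectrum A)) < 1"
      using fin sp by (subst Max_less_iff) (auto simp: unit_disc_def)
    then obtain r where r: "Max (insert 0 (norm ` spectrum A)) < r" "r < 1"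
      using dense by blast
    then show ?thesis
      using that[of r] fin by (subst (asm) Max_less_iff) auto
  qed
  let ?A = "complex_of_real (1 / r) \<cdot>\<^sub>m A"
  have A': "?A \<in> carrier_mat n n"
    using A by simp
  have "spectral_radius ?A < 1"
  proof -
    obtain \<mu> where \<mu>: "\<mu> \<in> spectrum ?A" "spectral_radius ?A = norm \<mu>"
      using spectral_radius_mem_max(1)[OF A' n] by auto
    have "eigenvalue A (\<mu> / complex_of_real (1 / r))"
      using \<mu>(1) r(1) by (intro eigenvalue_smult[OF A]) (auto simp: spectrum_def)
    then have "norm (\<mu> / complex_of_real (1 / r)) < r"
      by (intro r(3)) (simp add: spectrum_def)
    then show ?thesis
      using r(1) \<mu>(2) by (simp add: norm_mult norm_divide)
  qed
  then obtain c where c: "\<And>k. norm_bound (?A ^\<^sub>m k) c"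
    using spectral_radius_jnf_norm_bound_less_1_upper_triangular[OF A'] by auto
  have "norm ((A ^\<^sub>m k) $$ (i,j)) \<le> c * r ^ k" if "i < n" "j < n" for k i j
  proof -
    have "norm ((?A ^\<^sub>m k) $$ (i,j)) \<le> c"
      using c[of k] A' that unfolding norm_bound_def
      by (metis carrier_matD pow_carrier_mat)
    moreover have "(?A ^\<^sub>m k) $$ (i,j) = complex_of_real (1 / r) ^ k * (A ^\<^sub>m k) $$ (i,j)"
      using A that pow_carrier_mat[OF A, of k]
      by (subst smult_pow_mat[OF A], subst index_smult_mat) auto
    then have "norm ((?A ^\<^sub>m k) $$ (i,j)) = norm ((A ^\<^sub>m k) $$ (i,j)) / r ^ k"
      using r(1) by (simp add: norm_mult norm_divide norm_power power_divide)
    ultimately show ?thesis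
      using r(1) by (simp add: pos_divide_le_eq)
  qed
  then show ?thesis
    using that r by blast
qed

text \<open>The embedding into the complex numbers commutes with matrix powers and preserves
  absolute values of entries, so the complex bound transfers.\<close>

lemma real_spectrum_imp_geometric_decay:
  fixes A :: "real mat"
  assumes A: "A \<in> carrier_mat n n"
    and sp: "spectrum (map_mat complex_of_real A) \<subseteq> unit_disc"
  obtains r c where "0 < r" "r < 1"
    "\<forall>k. \<forall>i<n. \<forall>j<n. \<bar>(A ^\<^sub>m k) $$ (i,j)\<bar> \<le> c * r ^ k"
proof -
  have A': "map_mat complex_of_real A \<in> carrier_mat n n"
    using A by simp
  obtain r c where cr: "0 < r" "r < 1"
    "\<forall>k. \<forall>i<n. \<forall>j<n.
      norm ((map_mat complex_of_real A ^\<^sub>m k) $$ (i,j)) \<le> c * r ^ k"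
    using spectrum_unit_disc_imp_geometric_decay[OF A' sp] by blast
  have "\<bar>(A ^\<^sub>m k) $$ (i,j)\<bar> \<le> c * r ^ k" if "i < n" "j < n" for k i j
    using cr(3)[rule_format, OF that, of k] that A pow_carrier_mat[OF A, of k]
    by (simp add: of_real_hom.mat_hom_pow[OF A, symmetric])
  then show ?thesis
    using that[of r c] cr(1,2) by blast
qed

section \<open>The Lyapunov series\<close>

text \<open>Each entry of \<open>transpose_mat (A ^\<^sub>m k) * W * A ^\<^sub>m k\<close> is a
  finite sum of terms with two factors from \<open>A ^\<^sub>m k\<close>, hence of order
  \<open>(r\<^sup>2) ^ k\<close>. The series therefore converges entrywise, and \<open>P\<close> is
  its sum.\<close>

lemma lyapunov_series:
  fixes A W :: "real mat"
  assumes A: "A \<in> carrier_mat n n" and W: "W \<in> carrier_mat n n" and sym: "transpose_mat W = W"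
    and sp: "spectrum (map_mat complex_of_real A) \<subseteq> unit_disc"
  obtains P where "P \<in> carrier_mat n n" "transpose_mat P = P"
    "\<And>x. x \<in> carrier_vec n \<Longrightarrow>
      (\<lambda>k. (A ^\<^sub>m k *\<^sub>v x) \<bullet> (W *\<^sub>v (A ^\<^sub>m k *\<^sub>v x))) sums (x \<bullet> (P *\<^sub>v x))"
proof -
  obtain r c where r: "0 < r" "r < 1" and
    c: "\<forall>k. \<forall>i<n. \<forall>j<n. \<bar>(A ^\<^sub>m k) $$ (i,j)\<bar> \<le> c * r ^ k"
    using real_spectrum_imp_geometric_decay[OF A sp] by blast
  define S where "S k = transpose_mat (A ^\<^sub>m k) * W * A ^\<^sub>m k" for k
  define P where "P = mat n n (\<lambda>(i,j). \<Sum>k. S k $$ (i,j))"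
  have S: "S k \<in> carrier_mat n n" for k
    unfolding S_def using A W pow_carrier_mat[OF A, of k] by auto
  have "transpose_mat (S k) = S k" for k
    unfolding S_def using W sym pow_carrier_mat[OF A, of k] by (intro congruence_symmetric) auto
  then have S_sym: "S k $$ (i,j) = S k $$ (j,i)" if "i < n" "j < n" for i j k
    using S[of k] that by (metis carrier_matD index_transpose_mat(1))
  have P: "P \<in> carrier_mat n n" "transpose_mat P = P"
    unfolding P_def using S_sym by auto
  have entry: "S k $$ (i,j) =
      (\<Sum>a<n. \<Sum>b<n. (A ^\<^sub>m k) $$ (a,i) * (W $$ (a,b) * (A ^\<^sub>m k) $$ (b,j)))"
    if "i < n" "j < n" for i j k
  proof -
    have cols: "col (A ^\<^sub>m k) l \<in> carrier_vec n"
      "a < n \<Longrightarrow> l < n \<Longrightarrow> col (A ^\<^sub>m k) l $ a = (A ^\<^sub>m k) $$ (a,l)" for a l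
      using carrier_matD[OF pow_carrier_mat[OF A, of k]] by (simp_all add: col_def)
    have "S k $$ (i,j) = col (A ^\<^sub>m k) i \<bullet> (W *\<^sub>v col (A ^\<^sub>m k) j)"
      unfolding S_def using that A W pow_carrier_mat[OF A, of k]
      by (subst assoc_mult_mat[of _ n n _ n _ n]) (auto simp: scalar_prod_def)
    also have "\<dots> = (\<Sum>a<n. \<Sum>b<n. (A ^\<^sub>m k) $$ (a,i) * (W $$ (a,b) * (A ^\<^sub>m k) $$ (b,j)))"
      using that W by (subst scalar_prod_mult_mat_vec_sum[of _ n n]) (simp_all add: cols)
    finally show ?thesis .
  qed
  have "summable (\<lambda>k. (A ^\<^sub>m k) $$ (a,i) * (W $$ (a,b) * (A ^\<^sub>m k) $$ (b,j)))"
    if "i < n" "j < n" "a < n" "b < n" for i j a b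
  proof (rule summable_comparison_test')
    have "summable (\<lambda>k. (r\<^sup>2) ^ k)"
      using r by (intro summable_geometric) (simp add: power_less_one_iff abs_square_less_1)
    then show "summable (\<lambda>k. (c * \<bar>W $$ (a,b)\<bar> * c) * (r\<^sup>2) ^ k)"
      by (rule summable_mult)
    fix k :: nat
    \<comment> \<open>Monotonicity of the product needs \<open>c * r ^ k\<close> to be nonnegative,
      which holds because it bounds an absolute value.\<close>
    have "\<bar>(A ^\<^sub>m k) $$ (a,i)\<bar> * (\<bar>W $$ (a,b)\<bar> * \<bar>(A ^\<^sub>m k) $$ (b,j)\<bar>)
        \<le> (c * r ^ k) * (\<bar>W $$ (a,b)\<bar> * (c * r ^ k))"
      using c[rule_format, of a i k] c[rule_format, of b j k] that
        order_trans[OF abs_ge_zero c[rule_format, of a i k]]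
      by (intro mult_mono) auto
    then show "norm ((A ^\<^sub>m k) $$ (a,i) * (W $$ (a,b) * (A ^\<^sub>m k) $$ (b,j)))
        \<le> (c * \<bar>W $$ (a,b)\<bar> * c) * (r\<^sup>2) ^ k"
      by (simp add: abs_mult power2_eq_square power_mult_distrib mult_ac)
  qed
  then have summable_S: "summable (\<lambda>k. S k $$ (i,j))" if "i < n" "j < n" for i j
    using that by (simp add: entry) (intro summable_sum, auto)
  have "(\<lambda>k. (A ^\<^sub>m k *\<^sub>v x) \<bullet> (W *\<^sub>v (A ^\<^sub>m k *\<^sub>v x))) sums (x \<bullet> (P *\<^sub>v x))"
    if x: "x \<in> carrier_vec n" for x
  proof -
    \<comment> \<open>The form is a finite linear combination of entries, so the entrywise limits
      can be summed.\<close>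
    have "(\<lambda>k. \<Sum>i<n. \<Sum>j<n. x $ i * (S k $$ (i,j) * x $ j)) sums
        (\<Sum>i<n. \<Sum>j<n. x $ i * (P $$ (i,j) * x $ j))"
      unfolding P_def
      by (intro sums_sum sums_mult sums_mult2) (auto intro: summable_sums summable_S)
    moreover have "(\<Sum>i<n. \<Sum>j<n. x $ i * (S k $$ (i,j) * x $ j))
        = (A ^\<^sub>m k *\<^sub>v x) \<bullet> (W *\<^sub>v (A ^\<^sub>m k *\<^sub>v x))" for k
      unfolding scalar_prod_mult_mat_vec_sum[OF S x x, symmetric]
      using congruence_scalar_prod[OF pow_carrier_mat[OF A, of k] W x x] unfolding S_def .
    ultimately show ?thesis
      by (simp add: scalar_prod_mult_mat_vec_sum[OF P(1) x x])
  qed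
  with P show ?thesis
    using that[of P] by simp
qed

section \<open>From stability and a cost bound to a certificate\<close>

text \<open>Reads the certificate matrix along the dynamics: the change of the Lyapunov value in one
  step plus the stage cost.\<close>

lemma lyapunov_difference:
  fixes A :: "'a :: comm_ring mat"
  assumes "A \<in> carrier_mat n n" "P \<in> carrier_mat n n" "W \<in> carrier_mat n n" "x \<in> carrier_vec n"
  shows "x \<bullet> ((transpose_mat A * P * A - P + W) *\<^sub>v x)
    = (A *\<^sub>v x) \<bullet> (P *\<^sub>v (A *\<^sub>v x)) - x \<bullet> (P *\<^sub>v x) + x \<bullet> (W *\<^sub>v x)"
proof -
  have TC: "transpose_mat A * P * A \<in> carrier_mat n n"
    using assms by auto
  have "x \<bullet> ((transpose_mat A * P * A - P) *\<^sub>v x)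
      = x \<bullet> ((transpose_mat A * P * A) *\<^sub>v x) - x \<bullet> (P *\<^sub>v x)"
    using TC assms(2,4) by (rule minus_mat_quadratic)
  moreover have "x \<bullet> ((transpose_mat A * P * A - P + W) *\<^sub>v x)
      = x \<bullet> ((transpose_mat A * P * A - P) *\<^sub>v x) + x \<bullet> (W *\<^sub>v x)"
    using assms by (intro add_mat_quadratic) auto
  ultimately show ?thesis
    using congruence_scalar_prod[OF assms(1,2,4,4)] by simp
qed

lemma lyapunov_difference_symmetric:
  fixes A :: "'a :: comm_ring mat"
  assumes "A \<in> carrier_mat n n" "P \<in> carrier_mat n n" "W \<in> carrier_mat n n"
    "transpose_mat P = P" "transpose_mat W = W"
  shows "transpose_mat (transpose_mat A * P * A - P + W) = transpose_mat A * P * A - P + W"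
proof -
  have "transpose_mat (transpose_mat A * P * A - P) = transpose_mat A * P * A - P"
    using assms congruence_symmetric[of A n n P]
    by (subst transpose_minus[of _ n n]) auto
  then show ?thesis
    using assms by (subst transpose_add_mat[of _ n n]) auto
qed

lemma lyapunov_certificate_exists:
  fixes A W :: "real mat"
  assumes A: "A \<in> carrier_mat n n" and W: "pos_semidef n W" and x0: "x0 \<in> carrier_vec n"
    and sp: "spectrum (map_mat complex_of_real A) \<subseteq> unit_disc"
    and cost: "(\<Sum>k. ereal ((A ^\<^sub>m k *\<^sub>v x0) \<bullet> (W *\<^sub>v (A ^\<^sub>m k *\<^sub>v x0)))) < ereal d"
  shows "\<exists>P. pos_def n P \<and> neg_def n (transpose_mat A * P * A - P + W) \<and> x0 \<bullet> (P *\<^sub>v x0) < d"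
proof -
  note Wc = W[unfolded pos_semidef_def]
  obtain P where P: "P \<in> carrier_mat n n" "transpose_mat P = P" and P_sums:
    "\<And>x. x \<in> carrier_vec n \<Longrightarrow>
      (\<lambda>k. (A ^\<^sub>m k *\<^sub>v x) \<bullet> (W *\<^sub>v (A ^\<^sub>m k *\<^sub>v x))) sums (x \<bullet> (P *\<^sub>v x))"
    using Wc lyapunov_series[OF A _ _ sp, of W] by blast
  obtain H where H: "H \<in> carrier_mat n n" "transpose_mat H = H" and H_sums:
    "\<And>x. x \<in> carrier_vec n \<Longrightarrow>
      (\<lambda>k. (A ^\<^sub>m k *\<^sub>v x) \<bullet> (1\<^sub>m n *\<^sub>v (A ^\<^sub>m k *\<^sub>v x))) sums (x \<bullet> (H *\<^sub>v x))"
    using lyapunov_series[OF A one_carrier_mat transpose_one sp] by blast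
  \<comment> \<open>The series started at \<open>A *\<^sub>v x\<close> is the one started at
    \<open>x\<close> without its first term. This is the Lyapunov equation as an identity of forms;
    it serves both \<open>P\<close> with \<open>W\<close> and \<open>H\<close> with the
    identity.\<close>
  have step: "(A *\<^sub>v x) \<bullet> (Y *\<^sub>v (A *\<^sub>v x)) = x \<bullet> (Y *\<^sub>v x) - x \<bullet> (V *\<^sub>v x)"
    if x: "x \<in> carrier_vec n" and Y: "\<And>x. x \<in> carrier_vec n \<Longrightarrow>
      (\<lambda>k. (A ^\<^sub>m k *\<^sub>v x) \<bullet> (V *\<^sub>v (A ^\<^sub>m k *\<^sub>v x))) sums (x \<bullet> (Y *\<^sub>v x))"
    for x Y V
  proof -
    have "A ^\<^sub>m k *\<^sub>v (A *\<^sub>v x) = A ^\<^sub>m Suc k *\<^sub>v x" for k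
      using assoc_mult_mat_vec[OF pow_carrier_mat[OF A] A x] by simp
    then have "(\<lambda>k. (A ^\<^sub>m Suc k *\<^sub>v x) \<bullet> (V *\<^sub>v (A ^\<^sub>m Suc k *\<^sub>v x)))
        sums ((A *\<^sub>v x) \<bullet> (Y *\<^sub>v (A *\<^sub>v x)))"
      using Y[OF mult_mat_vec_carrier[OF A x]] by simp
    moreover have "(\<lambda>k. (A ^\<^sub>m Suc k *\<^sub>v x) \<bullet> (V *\<^sub>v (A ^\<^sub>m Suc k *\<^sub>v x)))
        sums (x \<bullet> (Y *\<^sub>v x) - x \<bullet> (V *\<^sub>v x))"
      using Y[OF x] A x by (subst sums_Suc_iff) simp
    ultimately show ?thesis
      by (rule sums_unique2)
  qed
  have P_nonneg: "0 \<le> x \<bullet> (P *\<^sub>v x)" if x: "x \<in> carrier_vec n" for x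
    using Wc pow_carrier_mat[OF A] x
    by (intro sums_le[OF _ sums_zero P_sums[OF x]]) (metis mult_mat_vec_carrier)
  have pos: "0 < x \<bullet> x" if "x \<in> carrier_vec n" "x \<noteq> 0\<^sub>v n" for x :: "real vec"
    using that conjugate_square_greater_0_vec[of x n] by simp
  \<comment> \<open>The series for \<open>H\<close> starts with \<open>x \<bullet> x\<close>, and
    its remainder is the nonnegative value of \<open>H\<close> at
    \<open>A *\<^sub>v x\<close>.\<close>
  have H_ge: "x \<bullet> x \<le> x \<bullet> (H *\<^sub>v x)" if x: "x \<in> carrier_vec n" for x
  proof -
    have "0 \<le> y \<bullet> (1\<^sub>m n *\<^sub>v y)" if "y \<in> carrier_vec n" for y :: "real vec"
      using that by (simp add: scalar_prod_def sum_nonneg)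
    then have "0 \<le> (A *\<^sub>v x) \<bullet> (H *\<^sub>v (A *\<^sub>v x))"
      using pow_carrier_mat[OF A] A x
      by (intro sums_le[OF _ sums_zero H_sums[of "A *\<^sub>v x"]]) (metis mult_mat_vec_carrier)+
    then show ?thesis
      using step[OF x H_sums] x by simp
  qed
  have P0: "x0 \<bullet> (P *\<^sub>v x0) < d"
    using cost sums_unique[OF sums_ereal[THEN iffD2, OF P_sums[OF x0]], symmetric] by simp
  have H0: "0 \<le> x0 \<bullet> (H *\<^sub>v x0)"
    using H_ge[OF x0] by (simp add: scalar_prod_def sum_nonneg order_trans[rotated])
  \<comment> \<open>The slack at \<open>x0\<close> is divided by a number exceeding the value of
    \<open>H\<close> there, so adding \<open>\<epsilon>\<close> times \<open>H\<close> keeps the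
    value below \<open>d\<close>. The summand 1 keeps the denominator positive even if
    \<open>x0\<close> is zero.\<close>
  define \<epsilon> where "\<epsilon> = (d - x0 \<bullet> (P *\<^sub>v x0)) / (1 + x0 \<bullet> (H *\<^sub>v x0))"
  have \<epsilon>: "0 < \<epsilon>" "\<epsilon> * (1 + x0 \<bullet> (H *\<^sub>v x0)) = d - x0 \<bullet> (P *\<^sub>v x0)"
    using P0 H0 by (simp_all add: \<epsilon>_def)
  let ?P = "P + \<epsilon> \<cdot>\<^sub>m H"
  have Pc: "?P \<in> carrier_mat n n"
    using P H by simp
  have Psym: "transpose_mat ?P = ?P"
  proof -
    have "transpose_mat (\<epsilon> \<cdot>\<^sub>m H) = \<epsilon> \<cdot>\<^sub>m transpose_mat H"
      using H(1) by (intro eq_matI) auto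
    then show ?thesis
      using P H by (simp add: transpose_add_mat[of _ n n])
  qed
  have Pq: "x \<bullet> (?P *\<^sub>v x) = x \<bullet> (P *\<^sub>v x) + \<epsilon> * (x \<bullet> (H *\<^sub>v x))" if x: "x \<in> carrier_vec n" for x
  proof -
    have "(\<epsilon> \<cdot>\<^sub>m H) *\<^sub>v x = \<epsilon> \<cdot>\<^sub>v (H *\<^sub>v x)"
      using H x by (intro eq_vecI) auto
    then show ?thesis
      using P H x by (simp add: add_mat_quadratic)
  qed
  have "pos_def n ?P"
    unfolding pos_def_def
  proof (intro conjI ballI impI Pc Psym)
    fix x :: "real vec" assume x: "x \<in> carrier_vec n" "x \<noteq> 0\<^sub>v n"
    then have "0 < \<epsilon> * (x \<bullet> (H *\<^sub>v x))"
      using H_ge pos \<epsilon> by (intro mult_pos_pos) force+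
    then show "0 < x \<bullet> (?P *\<^sub>v x)"
      using Pq[OF x(1)] P_nonneg[OF x(1)] by simp
  qed
  moreover have "neg_def n (transpose_mat A * ?P * A - ?P + W)"
    unfolding neg_def_def
  proof (intro conjI ballI impI)
    show "transpose_mat A * ?P * A - ?P + W \<in> carrier_mat n n"
      using A Pc Wc by auto
    show "transpose_mat (transpose_mat A * ?P * A - ?P + W) = transpose_mat A * ?P * A - ?P + W"
      using A Pc Wc Psym by (intro lyapunov_difference_symmetric) auto
    fix x :: "real vec" assume x: "x \<in> carrier_vec n" "x \<noteq> 0\<^sub>v n"
    \<comment> \<open>By the two Lyapunov equations \<open>P\<close> contributes minus the
      \<open>W\<close> term, which cancels, and \<open>H\<close> contributes
      \<open>- (x \<bullet> x)\<close>.\<close>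
    have "x \<bullet> ((transpose_mat A * ?P * A - ?P + W) *\<^sub>v x) = - \<epsilon> * (x \<bullet> x)"
      unfolding lyapunov_difference[OF A Pc conjunct1[OF Wc] x(1)] Pq[OF x(1)]
        Pq[OF mult_mat_vec_carrier[OF A x(1)]]
      using x(1) by (simp add: step[OF x(1) P_sums] step[OF x(1) H_sums] algebra_simps)
    then show "x \<bullet> ((transpose_mat A * ?P * A - ?P + W) *\<^sub>v x) < 0"
      using pos[OF x] \<epsilon>(1) by simp
  qed
  moreover have "x0 \<bullet> (?P *\<^sub>v x0) < d"
    using \<epsilon> Pq[OF x0] by (simp add: algebra_simps)
  ultimately show ?thesis
    by blast
qed

section \<open>From a certificate to stability and the cost bound\<close>

text \<open>Along the real and imaginary parts \<open>a\<close>, \<open>b\<close> of an eigenvector for \<open>\<mu>\<close>, the sum of the two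
  Lyapunov values is multiplied by \<open>\<bar>\<mu>\<bar>\<^sup>2\<close>, while the certificate makes it strictly decrease.\<close>

lemma lyapunov_certificate_imp_spectrum:
  fixes A W :: "real mat"
  assumes A: "A \<in> carrier_mat n n" and W: "pos_semidef n W" and P: "pos_def n P"
    and neg: "neg_def n (transpose_mat A * P * A - P + W)"
  shows "spectrum (map_mat complex_of_real A) \<subseteq> unit_disc"
proof
  fix \<mu> assume "\<mu> \<in> spectrum (map_mat complex_of_real A)"
  then obtain v where v: "v \<in> carrier_vec n" "v \<noteq> 0\<^sub>v n"
    and ev: "map_mat complex_of_real A *\<^sub>v v = \<mu> \<cdot>\<^sub>v v"
    using A unfolding spectrum_def eigenvalue_def eigenvector_def by auto
  note Wc = W[unfolded pos_semidef_def] and Pc = P[unfolded pos_def_def]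
  define a where "a = map_vec Re v"
  define b where "b = map_vec Im v"
  have ab: "a \<in> carrier_vec n" "b \<in> carrier_vec n"
    using v(1) by (auto simp: a_def b_def)
  \<comment> \<open>Since the entries of \<open>A\<close> are real, taking \<open>Re\<close> and
    \<open>Im\<close> of each coordinate gives the action of \<open>A\<close> on \<open>a\<close>
    and \<open>b\<close>: a rotation combined with scaling by the modulus of \<mu>.\<close>
  have ev_i: "(\<Sum>j<n. complex_of_real (A $$ (i,j)) * v $ j) = \<mu> * v $ i" if "i < n" for i
    using arg_cong[OF ev, of "\<lambda>w. w $ i"] that A v(1)
    by (simp add: scalar_prod_def atLeast0LessThan)
  have Aa: "A *\<^sub>v a = Re \<mu> \<cdot>\<^sub>v a + (- Im \<mu>) \<cdot>\<^sub>v b"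
  proof (rule eq_vecI)
    fix i assume "i < dim_vec (Re \<mu> \<cdot>\<^sub>v a + (- Im \<mu>) \<cdot>\<^sub>v b)"
    then have i: "i < n" using ab by simp
    show "(A *\<^sub>v a) $ i = (Re \<mu> \<cdot>\<^sub>v a + (- Im \<mu>) \<cdot>\<^sub>v b) $ i"
      using arg_cong[OF ev_i[OF i], of Re] i A v(1)
      by (simp add: a_def b_def scalar_prod_def atLeast0LessThan)
  qed (use A ab in auto)
  have Ab: "A *\<^sub>v b = Im \<mu> \<cdot>\<^sub>v a + Re \<mu> \<cdot>\<^sub>v b"
  proof (rule eq_vecI)
    fix i assume "i < dim_vec (Im \<mu> \<cdot>\<^sub>v a + Re \<mu> \<cdot>\<^sub>v b)"
    then have i: "i < n" using ab by simp
    show "(A *\<^sub>v b) $ i = (Im \<mu> \<cdot>\<^sub>v a + Re \<mu> \<cdot>\<^sub>v b) $ i"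
      using arg_cong[OF ev_i[OF i], of Im] i A v(1)
      by (simp add: a_def b_def scalar_prod_def atLeast0LessThan)
  qed (use A ab in auto)
  have nz: "a \<noteq> 0\<^sub>v n \<or> b \<noteq> 0\<^sub>v n"
  proof (rule ccontr)
    assume "\<not> ?thesis"
    then have z: "a = 0\<^sub>v n" "b = 0\<^sub>v n" by auto
    have "v = 0\<^sub>v n"
    proof (rule eq_vecI)
      fix i assume i: "i < dim_vec (0\<^sub>v n :: complex vec)"
      have "a $ i = 0" "b $ i = 0" unfolding z using i by auto
      then show "v $ i = 0\<^sub>v n $ i" using i v(1) by (simp add: a_def b_def complex_eq_iff)
    qed (use v in auto)
    then show False using v(2) by simp
  qed
  define V where "V x = x \<bullet> (P *\<^sub>v x)" for x
  \<comment> \<open>With coefficients \<open>Re \<mu>\<close>, \<open>- Im \<mu>\<close> for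
    \<open>A *\<^sub>v a\<close> and \<open>Im \<mu>\<close>, \<open>Re \<mu>\<close> for
    \<open>A *\<^sub>v b\<close>, the two mixed terms cancel on adding.\<close>
  have comb: "V (s \<cdot>\<^sub>v a + t \<cdot>\<^sub>v b) = s\<^sup>2 * V a + 2 * s * t * (a \<bullet> (P *\<^sub>v b)) + t\<^sup>2 * V b" for s t
  proof -
    have Pab: "P *\<^sub>v a \<in> carrier_vec n" "P *\<^sub>v b \<in> carrier_vec n"
      using Pc ab by (meson mult_mat_vec_carrier)+
    have "b \<bullet> (P *\<^sub>v a) = a \<bullet> (P *\<^sub>v b)"
      using scalar_prod_transpose_mult_mat_vec[of P n n a b] ab Pc
        comm_scalar_prod[OF Pab(1) ab(2)] by simp
    moreover have "P *\<^sub>v (s \<cdot>\<^sub>v a + t \<cdot>\<^sub>v b) = s \<cdot>\<^sub>v (P *\<^sub>v a) + t \<cdot>\<^sub>v (P *\<^sub>v b)"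
      using Pc ab by (simp add: mult_add_distrib_mat_vec[of _ n n] mult_mat_vec[of _ n n])
    ultimately show ?thesis
      using ab Pab unfolding V_def
      by (simp add: add_scalar_prod_distrib[of _ n] scalar_prod_add_distrib[of _ n]
          power2_eq_square algebra_simps)
  qed
  have "V (A *\<^sub>v a) + V (A *\<^sub>v b) = ((Re \<mu>)\<^sup>2 + (Im \<mu>)\<^sup>2) * (V a + V b)"
    unfolding Aa Ab comb by (simp add: algebra_simps)
  then have scale: "V (A *\<^sub>v a) + V (A *\<^sub>v b) = (cmod \<mu>)\<^sup>2 * (V a + V b)"
    by (simp add: cmod_power2)
  have dec: "V (A *\<^sub>v x) < V x" if "x \<in> carrier_vec n" "x \<noteq> 0\<^sub>v n" for x
  proof -
    have "x \<bullet> ((transpose_mat A * P * A - P + W) *\<^sub>v x) < 0"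
      using neg that unfolding neg_def_def by blast
    moreover have "0 \<le> x \<bullet> (W *\<^sub>v x)"
      using Wc that by blast
    ultimately show ?thesis
      using lyapunov_difference[OF A _ _ that(1), of P W] Wc Pc by (simp add: V_def)
  qed
  \<comment> \<open>One of \<open>a\<close> and \<open>b\<close> may vanish, for instance for a real
    eigenvector; strict decrease of the sum then comes from the other.\<close>
  have zero: "V (A *\<^sub>v 0\<^sub>v n) = 0" "V (0\<^sub>v n) = 0"
  proof -
    have "M *\<^sub>v 0\<^sub>v n = 0\<^sub>v n" if "M \<in> carrier_mat n n" for M :: "real mat"
      using that by (intro eq_vecI) auto
    then show "V (A *\<^sub>v 0\<^sub>v n) = 0" "V (0\<^sub>v n) = 0"
      using A Pc by (simp_all add: V_def)
  qed
  have pos: "0 < V x" if "x \<in> carrier_vec n" "x \<noteq> 0\<^sub>v n" for x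
    using Pc that by (simp add: V_def)
  have "V (A *\<^sub>v a) + V (A *\<^sub>v b) < V a + V b" "0 < V a + V b"
    using nz dec[OF ab(1)] dec[OF ab(2)] pos[OF ab(1)] pos[OF ab(2)] zero
    by (cases "a = 0\<^sub>v n"; cases "b = 0\<^sub>v n"; simp)+
  then have "(cmod \<mu>)\<^sup>2 < 1"
    unfolding scale by (simp add: mult_less_cancel_right1)
  then show "\<mu> \<in> unit_disc"
    by (simp add: unit_disc_def abs_square_less_1)
qed

text \<open>Each stage cost is at most the drop of the Lyapunov value. The drops telescope, and the
  nonnegative final value is discarded, so all partial sums have the same bound.\<close>

lemma lyapunov_certificate_imp_cost:
  fixes A W :: "real mat"
  assumes A: "A \<in> carrier_mat n n" and W: "pos_semidef n W" and P: "pos_def n P"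
    and neg: "neg_def n (transpose_mat A * P * A - P + W)" and x0: "x0 \<in> carrier_vec n"
  shows "(\<Sum>k. ereal ((A ^\<^sub>m k *\<^sub>v x0) \<bullet> (W *\<^sub>v (A ^\<^sub>m k *\<^sub>v x0)))) \<le> ereal (x0 \<bullet> (P *\<^sub>v x0))"
proof -
  note Wc = W[unfolded pos_semidef_def] and Pc = pos_def_imp_pos_semidef[OF P, unfolded pos_semidef_def]
  define x where "x k = A ^\<^sub>m k *\<^sub>v x0" for k
  have xc: "x k \<in> carrier_vec n" for k
    unfolding x_def using pow_carrier_mat[OF A, of k] x0 by simp
  have xS: "x (Suc k) = A *\<^sub>v x k" for k
    unfolding x_def by (rule pow_mat_Suc_mult_vec[OF A x0])
  have step: "x k \<bullet> (W *\<^sub>v x k) \<le> x k \<bullet> (P *\<^sub>v x k) - x (Suc k) \<bullet> (P *\<^sub>v x (Suc k))" for k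
  proof -
    have "x k \<bullet> ((transpose_mat A * P * A - P + W) *\<^sub>v x k) \<le> 0"
    \<comment> \<open>\<open>neg_def\<close> speaks of nonzero vectors, but the trajectory may reach
      the origin, where the form is zero.\<close>
    proof (cases "x k = 0\<^sub>v n")
      case True
      then show ?thesis
        using neg mult_mat_vec_carrier[of "transpose_mat A * P * A - P + W" n n "x k"]
        by (simp add: neg_def_def)
    next
      case False
      then show ?thesis
        using neg xc[of k] by (simp add: neg_def_def less_imp_le)
    qed
    then show ?thesis
      using lyapunov_difference[OF A _ _ xc[of k], of P W] Wc Pc by (simp add: xS)
  qed
  have partial: "(\<Sum>k<K. x k \<bullet> (W *\<^sub>v x k)) \<le> x0 \<bullet> (P *\<^sub>v x0)" for K
  proof -
    have "(\<Sum>k<K. x k \<bullet> (W *\<^sub>v x k)) \<le> x 0 \<bullet> (P *\<^sub>v x 0) - x K \<bullet> (P *\<^sub>v x K)"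
      unfolding sum_lessThan_telescope'[of "\<lambda>k. x k \<bullet> (P *\<^sub>v x k)", symmetric]
      by (intro sum_mono step)
    also have "\<dots> \<le> x 0 \<bullet> (P *\<^sub>v x 0)"
      using Pc xc[of K] by simp
    also have "x 0 = x0"
      using A x0 by (simp add: x_def)
    finally show ?thesis .
  qed
  have "(\<Sum>k. ereal (x k \<bullet> (W *\<^sub>v x k))) \<le> ereal (x0 \<bullet> (P *\<^sub>v x0))"
    using Wc xc partial by (intro suminf_bound) auto
  then show ?thesis
    by (simp add: x_def)
qed

section \<open>Application to the game\<close>

text \<open>Plays the role of \<open>W\<close> in the Lyapunov lemmas.\<close>

definition stage_weight :: "of_game \<Rightarrow> (nat \<Rightarrow> real mat) \<Rightarrow> nat \<Rightarrow> real mat" where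
  "stage_weight G F i = transpose_mat (Cmat G i) * Qmat G i * Cmat G i
     + transpose_mat (Cmat G i) * transpose_mat (F i) * Rmat G i * F i * Cmat G i"

text \<open>Both summands are congruences of semidefinite matrices: \<open>Qmat G i\<close> by
  \<open>Cmat G i\<close>, and \<open>Rmat G i\<close> by \<open>F i * Cmat G i\<close> after
  regrouping.\<close>

lemma pos_semidef_stage_weight:
  assumes wf: "wf_game G" and F: "F \<in> profiles G" and i: "i \<in> players G"
  shows "pos_semidef (state_dim G) (stage_weight G F i)"
proof -
  have C: "Cmat G i \<in> carrier_mat (output_dim G i) (state_dim G)"
    and Q: "pos_semidef (output_dim G i) (Qmat G i)" and R: "pos_def (input_dim G i) (Rmat G i)"
    using wf i unfolding wf_game_def by blast+
  have Fi: "F i \<in> carrier_mat (input_dim G i) (output_dim G i)"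
    using F i unfolding profiles_def by blast
  have Rc: "Rmat G i \<in> carrier_mat (input_dim G i) (input_dim G i)"
    using R by (simp add: pos_def_def)
  have "transpose_mat (F i * Cmat G i) * Rmat G i * (F i * Cmat G i)
      = transpose_mat (Cmat G i) * transpose_mat (F i) * Rmat G i * F i * Cmat G i"
    using C Fi Rc transpose_mult[OF Fi C]
    by (simp add: assoc_mult_mat[of _ "state_dim G" "input_dim G i" _ "output_dim G i" _ "state_dim G"])
  moreover have "pos_semidef (state_dim G)
      (transpose_mat (F i * Cmat G i) * Rmat G i * (F i * Cmat G i))"
    using C Fi by (intro pos_semidef_congruence[OF pos_def_imp_pos_semidef[OF R]]) auto
  ultimately show ?thesis
    using pos_semidef_add[OF pos_semidef_congruence[OF Q C]] unfolding stage_weight_def by simp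
qed

lemma closed_loop_carrier:
  assumes wf: "wf_game G" and F: "F \<in> profiles G"
  shows "closed_loop G F \<in> carrier_mat (state_dim G) (state_dim G)"
proof -
  \<comment> \<open>The sum over the players is a \<open>finsum\<close> in the additive group of
    square matrices, whose closure property gives the dimensions.\<close>
  interpret M: abelian_group "module_mat TYPE(real) (state_dim G) (state_dim G)"
    by (rule abelian_group_mat)
  have "(\<lambda>j. Bmat G j * F j * Cmat G j) \<in>
      players G \<rightarrow> carrier (module_mat TYPE(real) (state_dim G) (state_dim G))"
    using wf F unfolding wf_game_def profiles_def by (fastforce simp: module_mat_simps)
  from M.finsum_closed[OF this] show ?thesis
    using wf unfolding closed_loop_def wf_game_def by (simp add: module_mat_simps)
qed

lemma trajectory_eq_pow:
  assumes wf: "wf_game G" and F: "F \<in> profiles G"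
  shows "trajectory G F k = closed_loop G F ^\<^sub>m k *\<^sub>v init_state G"
proof (induction k)
  case 0
  show ?case
    using closed_loop_carrier[OF assms] wf by (simp add: wf_game_def)
next
  case (Suc k)
  then show ?case
    using pow_mat_Suc_mult_vec[OF closed_loop_carrier[OF assms]] wf by (simp add: wf_game_def)
qed

lemma cost_eq_pow:
  assumes "wf_game G" "F \<in> profiles G"
  shows "cost G i F = (\<Sum>k. ereal ((closed_loop G F ^\<^sub>m k *\<^sub>v init_state G) \<bullet>
     (stage_weight G F i *\<^sub>v (closed_loop G F ^\<^sub>m k *\<^sub>v init_state G))))"
  unfolding cost_def trajectory_eq_pow[OF assms] stage_weight_def ..

lemma cost_certificate_iff:
  assumes wf: "wf_game G" and F: "F \<in> profiles G" and i: "i \<in> players G"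
  shows "cost_certificate G i d F P \<longleftrightarrow> pos_def (state_dim G) P
     \<and> neg_def (state_dim G)
         (transpose_mat (closed_loop G F) * P * closed_loop G F - P + stage_weight G F i)
     \<and> init_state G \<bullet> (P *\<^sub>v init_state G) < d"
\<comment> \<open>The two sides differ in how the matrix sum is bracketed. Reassociation needs the
  dimensions of \<open>P\<close>, taken from definiteness; without definiteness both sides are
  false.\<close>
proof (cases "pos_def (state_dim G) P")
  case True
  let ?n = "state_dim G"
  have C: "Cmat G i \<in> carrier_mat (output_dim G i) ?n"
    and Q: "Qmat G i \<in> carrier_mat (output_dim G i) (output_dim G i)"
    using wf i unfolding wf_game_def pos_semidef_def by blast+
  have "transpose_mat (closed_loop G F) * P * closed_loop G F - P \<in> carrier_mat ?n ?n"
    using True closed_loop_carrier[OF wf F] by (auto simp: pos_def_def)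
  moreover have "transpose_mat (Cmat G i) * Qmat G i * Cmat G i \<in> carrier_mat ?n ?n"
    using C Q by auto
  moreover have "transpose_mat (Cmat G i) * transpose_mat (F i) * Rmat G i * F i * Cmat G i
      \<in> carrier_mat ?n ?n"
    using C by auto
  ultimately show ?thesis
    unfolding cost_certificate_def stage_weight_def by (simp add: assoc_add_mat[of _ ?n ?n])
qed (simp add: cost_certificate_def)

text \<open>The Lyapunov lemmas for the closed loop and the stage weight. Conversely, a certificate
  bounds the cost by its value at the initial state, which lies strictly below
  \<open>d\<close>.\<close>

lemma cost_certificate_exists_iff:
  assumes wf: "wf_game G" and F: "F \<in> profiles G" and i: "i \<in> players G"
  shows "(cost G i F < ereal d \<and> closed_loop_spectrum G F \<subseteq> unit_disc)
    \<longleftrightarrow> (\<exists>P. cost_certificate G i d F P)"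
proof -
  have x0: "init_state G \<in> carrier_vec (state_dim G)"
    using wf by (simp add: wf_game_def)
  note A = closed_loop_carrier[OF wf F] and W = pos_semidef_stage_weight[OF wf F i]
  show ?thesis
    unfolding cost_certificate_iff[OF assms] closed_loop_spectrum_def cost_eq_pow[OF wf F]
    using lyapunov_certificate_exists[OF A W x0] lyapunov_certificate_imp_spectrum[OF A W]
      lyapunov_certificate_imp_cost[OF A W _ _ x0]
    by (meson ereal_less(2) ereal_less_eq(3) le_less_trans less_ereal.simps(1))
qed

theorem theorem6:
  fixes G :: of_game and \<delta> :: "nat \<Rightarrow> real" and F :: "nat \<Rightarrow> real mat"
  assumes "wf_game G"
    and "stabilizing G \<noteq> {}"
    and "\<forall>i\<in>players G. 0 < \<delta> i"
    and "F \<in> profiles G"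
  shows "(\<forall>i\<in>players G.
            (cost G i F < ereal (\<delta> i) \<and> closed_loop_spectrum G F \<subseteq> unit_disc)
            \<longleftrightarrow> (\<exists>P. cost_certificate G i (\<delta> i) F P))
       \<and> (of_gce G \<delta> F \<longleftrightarrow> (\<forall>i\<in>players G. \<exists>P. cost_certificate G i (\<delta> i) F P))"
proof -
  note iff = cost_certificate_exists_iff[OF assms(1,4)]
  \<comment> \<open>With at least one player, the conditions over all players yield the stability
    that \<open>of_gce\<close> also demands of the profile itself.\<close>
  have "1 \<in> players G"
    using assms(1) by (simp add: wf_game_def players_def)
  then have "of_gce G \<delta> F \<longleftrightarrow>
      (\<forall>i\<in>players G. cost G i F < ereal (\<delta> i) \<and> closed_loop_spectrum G F \<subseteq> unit_disc)"
    using assms(4)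
    unfolding of_gce_def guaranteed_cost_response_def stabilizing_def by (auto simp: profiles_def)
  then show ?thesis
    using iff by blast
qed

end
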